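(* Let $G$ be a split comparability graph. Then $\mathcal{R}(G)=3$ if and only if $G$ contains an induced subgraph isomorphic to $F_0$ or to $F_1(5)$.
   Context: A split graph is a graph whose vertex set can be partitioned into a clique and an independent set; a comparability graph is one admitting a transitive orientation (comparability graphs are word-representable). A graph $G=(V,E)$ is represented by a word $w$ over $V$ if for all distinct $a,b\in V$, $ab\in E$ iff $a$ and $b$ alternate in $w$ (i.e. the subsequence of $w$ formed by all occurrences of $a$ and $b$ is $abab\cdots$ or $baba\cdots$). A word is $k$-uniform if each letter occurs exactly $k$ times; $\mathcal{R}(G)$ is the least $k$ such that a $k$-uniform word represents $G$. $F_0$ is the split graph with clique $\{0,c_1,c_2,c_3,c_4\}$ and independent set $\{a_1,a_2,a_3\}$ with $N(a_1)=\{0,c_2,c_3\}$, $N(a_2)=\{0,c_3,c_4\}$, $N(a_3)=\{0,c_1,c_4\}$. $F_1(5)$ is the split graph with clique $\{c_1,c_2,c_3,c_4\}$ and independent set $\{a_1,a_2,a_3,b_1,b_2\}$ with $N(b_1)=\{c_1,c_2,c_3\}$, $N(b_2)=\{c_2,c_3,c_4\}$, $N(a_i)=\{c_i,c_{i+1}\}$ for $i=1,2,3$. *)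

theory Defs
  imports Main
begin

definition graph :: "'a set \<Rightarrow> ('a \<Rightarrow> 'a \<Rightarrow> bool) \<Rightarrow> bool" where
  "graph V E \<longleftrightarrow> finite V \<and> (\<forall>x y. E x y \<longrightarrow> x \<in> V \<and> y \<in> V \<and> x \<noteq> y)
     \<and> (\<forall>x y. E x y \<longrightarrow> E y x)"

definition clique :: "('a \<Rightarrow> 'a \<Rightarrow> bool) \<Rightarrow> 'a set \<Rightarrow> bool" where
  "clique E K \<longleftrightarrow> (\<forall>x\<in>K. \<forall>y\<in>K. x \<noteq> y \<longrightarrow> E x y)"

definition independent :: "('a \<Rightarrow> 'a \<Rightarrow> bool) \<Rightarrow> 'a set \<Rightarrow> bool" where
  "independent E I \<longleftrightarrow> (\<forall>x\<in>I. \<forall>y\<in>I. \<not> E x y)"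

definition split_graph :: "'a set \<Rightarrow> ('a \<Rightarrow> 'a \<Rightarrow> bool) \<Rightarrow> bool" where
  "split_graph V E \<longleftrightarrow> (\<exists>K I. K \<union> I = V \<and> K \<inter> I = {} \<and> clique E K \<and> independent E I)"

definition transitive_orientation :: "'a set \<Rightarrow> ('a \<Rightarrow> 'a \<Rightarrow> bool) \<Rightarrow> ('a \<Rightarrow> 'a \<Rightarrow> bool) \<Rightarrow> bool" where
  "transitive_orientation V E R \<longleftrightarrow>
     (\<forall>x\<in>V. \<forall>y\<in>V. E x y \<longleftrightarrow> R x y \<or> R y x)
   \<and> (\<forall>x\<in>V. \<forall>y\<in>V. R x y \<longrightarrow> \<not> R y x)
   \<and> (\<forall>x\<in>V. \<forall>y\<in>V. \<forall>z\<in>V. R x y \<longrightarrow> R y z \<longrightarrow> R x z)"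

definition comparability_graph :: "'a set \<Rightarrow> ('a \<Rightarrow> 'a \<Rightarrow> bool) \<Rightarrow> bool" where
  "comparability_graph V E \<longleftrightarrow> (\<exists>R. transitive_orientation V E R)"

definition alternate :: "'a list \<Rightarrow> 'a \<Rightarrow> 'a \<Rightarrow> bool" where
  "alternate w a b \<longleftrightarrow> (let u = filter (\<lambda>x. x = a \<or> x = b) w in
      \<forall>i. Suc i < length u \<longrightarrow> u ! i \<noteq> u ! Suc i)"

definition represents :: "'a list \<Rightarrow> 'a set \<Rightarrow> ('a \<Rightarrow> 'a \<Rightarrow> bool) \<Rightarrow> bool" where
  "represents w V E \<longleftrightarrow> set w \<subseteq> V \<and>
     (\<forall>a\<in>V. \<forall>b\<in>V. a \<noteq> b \<longrightarrow> (E a b \<longleftrightarrow> alternate w a b))"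

definition uniform :: "nat \<Rightarrow> 'a list \<Rightarrow> 'a set \<Rightarrow> bool" where
  "uniform k w V \<longleftrightarrow> (\<forall>v\<in>V. count_list w v = k)"

definition rep_number :: "'a set \<Rightarrow> ('a \<Rightarrow> 'a \<Rightarrow> bool) \<Rightarrow> nat" where
  "rep_number V E = (LEAST k. k \<ge> 1 \<and> (\<exists>w. uniform k w V \<and> represents w V E))"

definition has_induced :: "'a set \<Rightarrow> ('a \<Rightarrow> 'a \<Rightarrow> bool) \<Rightarrow> 'b set \<Rightarrow> ('b \<Rightarrow> 'b \<Rightarrow> bool) \<Rightarrow> bool" where
  "has_induced V E VH EH \<longleftrightarrow> (\<exists>f. inj_on f VH \<and> f ` VH \<subseteq> V \<and>
      (\<forall>x\<in>VH. \<forall>y\<in>VH. E (f x) (f y) \<longleftrightarrow> EH x y))"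

definition sym_edges :: "(nat \<times> nat) set \<Rightarrow> nat \<Rightarrow> nat \<Rightarrow> bool" where
  "sym_edges S x y \<longleftrightarrow> (x, y) \<in> S \<or> (y, x) \<in> S"

text \<open>F_0: vertices 0, c1..c4 = 1..4, a1,a2,a3 = 5,6,7.\<close>
definition F0_V :: "nat set" where "F0_V = {0..7}"
definition F0_E :: "nat \<Rightarrow> nat \<Rightarrow> bool" where
  "F0_E = sym_edges ({(x, y). x \<in> {0..4} \<and> y \<in> {0..4} \<and> x \<noteq> y}
     \<union> {(5,0),(5,2),(5,3), (6,0),(6,3),(6,4), (7,0),(7,1),(7,4)})"

text \<open>F_1(5): c1..c4 = 1..4, a1,a2,a3 = 5,6,7, b1,b2 = 8,9.\<close>
definition F1_5_V :: "nat set" where "F1_5_V = {1..9}"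
definition F1_5_E :: "nat \<Rightarrow> nat \<Rightarrow> bool" where
  "F1_5_E = sym_edges ({(x, y). x \<in> {1..4} \<and> y \<in> {1..4} \<and> x \<noteq> y}
     \<union> {(8,1),(8,2),(8,3), (9,2),(9,3),(9,4), (5,1),(5,2), (6,2),(6,3), (7,3),(7,4)})"

end

theory Submission
  imports Defs "HOL-Library.Product_Lexorder"
begin

text \<open>In a split comparability graph the clique splits into two parts \<open>L\<close> and \<open>R\<close> such that the
  neighbourhoods of the independent vertices form a chain in each part. After ranking \<open>L\<close> and \<open>R\<close>,
  an independent vertex \<open>x\<close> is a point \<open>(i x, j x)\<close>, adjacent to the elements of rank at most
  \<open>i x\<close> in \<open>L\<close> and at most \<open>j x\<close> in \<open>R\<close>. Three linear extensions of the corresponding order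
  represent the graph, so the representation number is at most 3.

  A 2-uniform word is a chord diagram. The clique is drawn as \<open>L R L R\<close>, and each independent vertex
  is a chord around one of the two junctions of \<open>L\<close> and \<open>R\<close>. Points that are incomparable but
  have a common neighbour must use different junctions, so a diagram exists if this conflict graph
  is bipartite. A triangle in it yields \<open>F\<^sub>0\<close>, and without triangles the only obstruction
  is the 5-cycle coming from \<open>F\<^sub>1(5)\<close>. Conversely, neither graph has a chord diagram.\<close>

section \<open>Uniform words and chord diagrams\<close>

lemma alternate_iff_distinct_adj:
  "alternate w a b \<longleftrightarrow> distinct_adj (filter (\<lambda>x. x = a \<or> x = b) w)"
  by (simp add: alternate_def distinct_adj_conv_nth Let_def)

lemma sorted_list_of_set_eqI:
  fixes xs :: "'k::linorder list"
  assumes "sorted_wrt (<) xs" "set xs = A"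
  shows "sorted_list_of_set A = xs"
  using assms by (metis List.finite_set strict_sorted_equal strict_sorted_list_of_set set_sorted_list_of_set)

lemma filter_map_sorted_list_of_set:
  assumes "finite P"
  shows "filter Q (map l (sorted_list_of_set P)) = map l (sorted_list_of_set {k \<in> P. Q (l k)})"
proof -
  have "sorted_list_of_set {k \<in> P. Q (l k)} = filter (Q \<circ> l) (sorted_list_of_set P)"
    using assms by (intro sorted_list_of_set_eqI sorted_wrt_filter) auto
  then show ?thesis by (simp add: filter_map)
qed

text \<open>The endpoints lie in an arbitrary linear order, so that word positions and lexicographic
  tuples can both serve.\<close>

definition crosses :: "('a \<Rightarrow> 'k::linorder) \<Rightarrow> ('a \<Rightarrow> 'k) \<Rightarrow> 'a \<Rightarrow> 'a \<Rightarrow> bool" where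
  "crosses f s x y \<longleftrightarrow> f x < f y \<and> f y < s x \<and> s x < s y \<or> f y < f x \<and> f x < s y \<and> s y < s x"

definition chords :: "('a \<Rightarrow> 'k::linorder) \<Rightarrow> ('a \<Rightarrow> 'k) \<Rightarrow> 'a set \<Rightarrow> bool" where
  "chords f s V \<longleftrightarrow> (\<forall>x\<in>V. f x < s x) \<and>
     (\<forall>x\<in>V. \<forall>y\<in>V. x \<noteq> y \<longrightarrow> f x \<noteq> f y \<and> s x \<noteq> s y \<and> f x \<noteq> s y)"

text \<open>Two chords can interleave in six ways; only the patterns abab and baba avoid equal
  neighbours.\<close>

lemma distinct_adj_chord_letters:
  fixes f s :: "'a \<Rightarrow> 'k::linorder"
  assumes "chords f s {a, b}" "a \<noteq> b" and "l (f a) = a" "l (s a) = a" "l (f b) = b" "l (s b) = b"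
  shows "distinct_adj (map l (sorted_list_of_set {f a, s a, f b, s b})) \<longleftrightarrow> crosses f s a b"
proof -
  let ?D = "{f a, s a, f b, s b}"
  have lt: "f a < s a" "f b < s b" and ne: "f a \<noteq> f b" "s a \<noteq> s b" "f a \<noteq> s b" "f b \<noteq> s a"
    using assms(1,2) by (auto simp: chords_def)
  consider "f a < f b" "s b < s a" | "f a < f b" "f b < s a" "s a < s b" | "s a < f b"
    | "f b < f a" "s a < s b" | "f b < f a" "f a < s b" "s b < s a" | "s b < f a"
    using lt ne by (metis linorder_less_linear)
  then show ?thesis
  proof cases
    case 1
    then have "sorted_list_of_set ?D = [f a, f b, s b, s a]"
      using lt by (intro sorted_list_of_set_eqI) auto
    then show ?thesis using 1 assms by (auto simp: crosses_def)
  next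
    case 2
    then have "sorted_list_of_set ?D = [f a, f b, s a, s b]"
      using lt by (intro sorted_list_of_set_eqI) auto
    then show ?thesis using 2 assms by (auto simp: crosses_def)
  next
    case 3
    then have "sorted_list_of_set ?D = [f a, s a, f b, s b]"
      using lt by (intro sorted_list_of_set_eqI) auto
    then show ?thesis using 3 lt assms by (auto simp: crosses_def)
  next
    case 4
    then have "sorted_list_of_set ?D = [f b, f a, s a, s b]"
      using lt by (intro sorted_list_of_set_eqI) auto
    then show ?thesis using 4 assms by (auto simp: crosses_def)
  next
    case 5
    then have "sorted_list_of_set ?D = [f b, f a, s b, s a]"
      using lt by (intro sorted_list_of_set_eqI) auto
    then show ?thesis using 5 assms by (auto simp: crosses_def)
  next
    case 6
    then have "sorted_list_of_set ?D = [f b, s b, f a, s a]"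
      using lt by (intro sorted_list_of_set_eqI) auto
    then show ?thesis using 6 lt assms by (auto simp: crosses_def)
  qed
qed

lemma count_list_map_sorted_list_of_set:
  assumes "finite P"
  shows "count_list (map l (sorted_list_of_set P)) v = card {k \<in> P. l k = v}"
proof -
  have "count_list (map l (sorted_list_of_set P)) v = length (filter ((=) v) (map l (sorted_list_of_set P)))"
    by (simp add: count_list_eq_length_filter)
  also have "\<dots> = card {k \<in> P. v = l k}"
    using assms by (simp only: filter_map_sorted_list_of_set) simp
  finally show ?thesis by (simp add: eq_commute)
qed

lemma two_uniform_word_of_chords:
  fixes f s :: "'a \<Rightarrow> 'k::linorder"
  assumes "finite V" and ch: "chords f s V"
    and E: "\<And>x y. x \<in> V \<Longrightarrow> y \<in> V \<Longrightarrow> x \<noteq> y \<Longrightarrow> E x y \<longleftrightarrow> crosses f s x y"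
  shows "\<exists>w. uniform 2 w V \<and> represents w V E"
proof -
  define l where "l k = (SOME v. v \<in> V \<and> (f v = k \<or> s v = k))" for k
  have l: "l (f v) = v" "l (s v) = v" if "v \<in> V" for v
    unfolding l_def using that ch
    by (intro some_equality; auto simp: chords_def; metis order.irrefl)+
  define P where "P = f ` V \<union> s ` V"
  have fin: "finite P" using assms(1) by (simp add: P_def)
  define w where "w = map l (sorted_list_of_set P)"
  have fs: "f v < s v" if "v \<in> V" for v using ch that by (auto simp: chords_def)
  have pos: "{k \<in> P. l k = v} = {f v, s v}" if "v \<in> V" for v
    using that l by (auto simp: P_def)
  have "uniform 2 w V"
    using fin fs pos by (fastforce simp: uniform_def w_def count_list_map_sorted_list_of_set)
  moreover have "alternate w a b \<longleftrightarrow> crosses f s a b" if ab: "a \<in> V" "b \<in> V" "a \<noteq> b" for a b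
  proof -
    have "{k \<in> P. l k = a \<or> l k = b} = {f a, s a, f b, s b}"
      using pos[OF ab(1)] pos[OF ab(2)] by blast
    then have "filter (\<lambda>x. x = a \<or> x = b) w = map l (sorted_list_of_set {f a, s a, f b, s b})"
      unfolding w_def by (simp only: filter_map_sorted_list_of_set[OF fin])
    moreover have "chords f s {a, b}" using ch ab by (auto simp: chords_def)
    ultimately show ?thesis
      using distinct_adj_chord_letters[of f s a b l] ab l
      by (simp only: alternate_iff_distinct_adj simp_thms)
  qed
  moreover have "set w \<subseteq> V" using fin l by (auto simp: w_def P_def)
  ultimately show ?thesis using E by (auto simp: represents_def)
qed

lemma chords_of_two_uniform_word:
  assumes "uniform 2 w V" "represents w V E"
  obtains f s :: "'a \<Rightarrow> nat" where "chords f s V"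
    and "\<And>x y. x \<in> V \<Longrightarrow> y \<in> V \<Longrightarrow> x \<noteq> y \<Longrightarrow> E x y \<longleftrightarrow> crosses f s x y"
proof -
  let ?pos = "\<lambda>v. {k. k < length w \<and> w ! k = v}"
  have w: "w = map (nth w) (sorted_list_of_set {..<length w})"
    by (simp add: lessThan_atLeast0 map_nth)
  have "\<exists>m n. m < n \<and> ?pos v = {m, n}" if "v \<in> V" for v
  proof -
    have "card {k \<in> {..<length w}. w ! k = v} = 2"
      using that assms(1) w by (metis uniform_def count_list_map_sorted_list_of_set finite_lessThan)
    then have "card (?pos v) = 2" by simp
    then obtain m n where "?pos v = {m, n}" "m \<noteq> n" by (auto simp: card_2_iff)
    then show ?thesis by (metis insert_commute linorder_neqE_nat)
  qed
  then obtain f s where fs: "f v < s v" "?pos v = {f v, s v}" if "v \<in> V" for v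
    by metis
  have l: "w ! f v = v" "w ! s v = v" if "v \<in> V" for v using fs(2)[OF that] by blast+
  have ch: "chords f s V" unfolding chords_def using fs(1) l by metis
  have "alternate w a b \<longleftrightarrow> crosses f s a b" if ab: "a \<in> V" "b \<in> V" "a \<noteq> b" for a b
  proof -
    have "{k \<in> {..<length w}. w ! k = a \<or> w ! k = b} = {f a, s a, f b, s b}"
      using fs(2)[OF ab(1)] fs(2)[OF ab(2)] by blast
    then have "filter (\<lambda>x. x = a \<or> x = b) w = map (nth w) (sorted_list_of_set {f a, s a, f b, s b})"
      by (subst w) (simp only: filter_map_sorted_list_of_set finite_lessThan)
    moreover have "chords f s {a, b}" using ch ab by (auto simp: chords_def)
    ultimately show ?thesis
      using distinct_adj_chord_letters[of f s a b "(!) w"] ab l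
      by (simp only: alternate_iff_distinct_adj simp_thms)
  qed
  then show ?thesis using that[OF ch] assms(2) by (auto simp: represents_def)
qed

section \<open>Words made of three permutations\<close>

lemma permutation_of_key:
  fixes \<kappa> :: "'a \<Rightarrow> 'k::linorder"
  assumes "finite V" "inj_on \<kappa> V"
  obtains w where "set w = V" "uniform 1 w V"
    "\<And>a b. a \<in> V \<Longrightarrow> b \<in> V \<Longrightarrow> \<kappa> a < \<kappa> b \<Longrightarrow> filter (\<lambda>x. x = a \<or> x = b) w = [a, b]"
proof -
  define l where "l = inv_into V \<kappa>"
  have l: "l (\<kappa> v) = v" if "v \<in> V" for v using assms(2) that by (simp add: l_def)
  define w where "w = map l (sorted_list_of_set (\<kappa> ` V))"
  have fin: "finite (\<kappa> ` V)" using assms(1) by simp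
  show thesis
  proof (rule that[of w])
    show "set w = V" using fin l by (force simp: w_def)
    have "{k \<in> \<kappa> ` V. l k = v} = {\<kappa> v}" if "v \<in> V" for v using l that by auto
    then show "uniform 1 w V"
      using fin by (simp add: uniform_def w_def count_list_map_sorted_list_of_set)
    fix a b assume ab: "a \<in> V" "b \<in> V" "\<kappa> a < \<kappa> b"
    have "{k \<in> \<kappa> ` V. l k = a \<or> l k = b} = {\<kappa> a, \<kappa> b}" using l ab by auto
    moreover have "sorted_list_of_set {\<kappa> a, \<kappa> b} = [\<kappa> a, \<kappa> b]"
      using ab by (intro sorted_list_of_set_eqI) auto
    ultimately show "filter (\<lambda>x. x = a \<or> x = b) w = [a, b]"
      unfolding w_def using l ab by (simp add: filter_map_sorted_list_of_set[OF fin])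
  qed
qed

text \<open>In a concatenation of three permutations, two letters alternate precisely if all three
  list them in the same order.\<close>

lemma three_uniform_word_of_keys:
  fixes \<kappa> \<mu> \<nu> :: "'a \<Rightarrow> 'k::linorder"
  assumes fin: "finite V" and inj: "inj_on \<kappa> V" "inj_on \<mu> V" "inj_on \<nu> V"
    and sym: "\<And>x y. E x y \<Longrightarrow> E y x"
    and E: "\<And>x y. x \<in> V \<Longrightarrow> y \<in> V \<Longrightarrow> \<kappa> x < \<kappa> y \<Longrightarrow> E x y \<longleftrightarrow> \<mu> x < \<mu> y \<and> \<nu> x < \<nu> y"
  shows "\<exists>w. uniform 3 w V \<and> represents w V E"
proof -
  obtain w1 where w1: "set w1 = V" "uniform 1 w1 V"
    "\<And>a b. a \<in> V \<Longrightarrow> b \<in> V \<Longrightarrow> \<kappa> a < \<kappa> b \<Longrightarrow> filter (\<lambda>x. x = a \<or> x = b) w1 = [a, b]"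
    using permutation_of_key[OF fin inj(1)] by blast
  obtain w2 where w2: "set w2 = V" "uniform 1 w2 V"
    "\<And>a b. a \<in> V \<Longrightarrow> b \<in> V \<Longrightarrow> \<mu> a < \<mu> b \<Longrightarrow> filter (\<lambda>x. x = a \<or> x = b) w2 = [a, b]"
    using permutation_of_key[OF fin inj(2)] by blast
  obtain w3 where w3: "set w3 = V" "uniform 1 w3 V"
    "\<And>a b. a \<in> V \<Longrightarrow> b \<in> V \<Longrightarrow> \<nu> a < \<nu> b \<Longrightarrow> filter (\<lambda>x. x = a \<or> x = b) w3 = [a, b]"
    using permutation_of_key[OF fin inj(3)] by blast
  let ?w = "w1 @ w2 @ w3"
  have comm: "(\<lambda>x. x = a \<or> x = b) = (\<lambda>x. x = b \<or> x = a)" for a b :: 'a by blast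
  have less: "E a b \<longleftrightarrow> alternate ?w a b" if ab: "a \<in> V" "b \<in> V" "\<kappa> a < \<kappa> b" for a b
  proof -
    have "a \<noteq> b" using ab by auto
    then have "\<mu> a \<noteq> \<mu> b" "\<nu> a \<noteq> \<nu> b" using inj ab by (auto dest: inj_onD)
    then have "filter (\<lambda>x. x = a \<or> x = b) w2 = (if \<mu> a < \<mu> b then [a, b] else [b, a])"
      "filter (\<lambda>x. x = a \<or> x = b) w3 = (if \<nu> a < \<nu> b then [a, b] else [b, a])"
      using w2(3)[OF ab(1,2)] w2(3)[OF ab(2,1)] w3(3)[OF ab(1,2)] w3(3)[OF ab(2,1)]
      by (auto simp: comm[of b a])
    then show ?thesis
      using w1(3)[OF ab] E[OF ab] \<open>a \<noteq> b\<close> by (auto simp: alternate_iff_distinct_adj)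
  qed
  have "E a b \<longleftrightarrow> alternate ?w a b" if ab: "a \<in> V" "b \<in> V" "a \<noteq> b" for a b
  proof (cases "\<kappa> a < \<kappa> b")
    case False
    then have "\<kappa> b < \<kappa> a" using ab inj(1) by (metis inj_on_def linorder_neqE)
    then have "E b a \<longleftrightarrow> alternate ?w b a" using less ab by blast
    moreover have "alternate ?w b a \<longleftrightarrow> alternate ?w a b"
      by (simp only: alternate_iff_distinct_adj comm[of b a])
    ultimately show ?thesis using sym by blast
  qed (use less ab in blast)
  then have "represents ?w V E" using w1(1) w2(1) w3(1) by (simp add: represents_def)
  moreover have "uniform 3 ?w V" using w1(2) w2(2) w3(2) by (simp add: uniform_def)
  ultimately show ?thesis by blast
qed

section \<open>Two graphs without chord diagrams\<close>

text \<open>For pairwise non-crossing chords: \<open>x\<close> and \<open>t\<close> lie on different sides of \<open>y\<close>.\<close>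

definition separates :: "('a \<Rightarrow> 'k::linorder) \<Rightarrow> ('a \<Rightarrow> 'k) \<Rightarrow> 'a \<Rightarrow> 'a \<Rightarrow> 'a \<Rightarrow> bool" where
  "separates f s y x t \<longleftrightarrow> (f y < f x \<and> f x < s y) \<noteq> (f y < f t \<and> f t < s y)"

text \<open>The endpoint of \<open>x\<close> between \<open>f z\<close> and \<open>s z\<close>, provided that \<open>x\<close> crosses \<open>z\<close>.
  The non-crossing pairs among the chords that cross \<open>z\<close> are ordered by the points where they
  meet \<open>z\<close>, and this order is transitive.\<close>

definition inner :: "('a \<Rightarrow> 'k::linorder) \<Rightarrow> ('a \<Rightarrow> 'k) \<Rightarrow> 'a \<Rightarrow> 'a \<Rightarrow> 'k" where
  "inner f s z x = (if f z < f x then f x else s x)"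

definition before_along :: "('a \<Rightarrow> 'k::linorder) \<Rightarrow> ('a \<Rightarrow> 'k) \<Rightarrow> 'a \<Rightarrow> 'a \<Rightarrow> 'a \<Rightarrow> bool" where
  "before_along f s z x y \<longleftrightarrow> x \<noteq> y \<and> crosses f s z x \<and> crosses f s z y \<and> \<not> crosses f s x y
     \<and> inner f s z x < inner f s z y"

lemma before_along_total:
  fixes f s :: "'a \<Rightarrow> nat"
  assumes "chords f s V" "x \<in> V" "y \<in> V" "x \<noteq> y" "\<not> crosses f s x y"
    and "crosses f s z x" "crosses f s z y"
  shows "before_along f s z x y \<or> before_along f s z y x"
proof -
  have "inner f s z x \<noteq> inner f s z y"
    using assms(1-4) unfolding chords_def inner_def by metis
  then show ?thesis using assms(4-7) by (auto simp: before_along_def crosses_def)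
qed

text \<open>The middle chord \<open>y\<close> crosses neither \<open>x\<close> nor \<open>t\<close>
  and meets \<open>z\<close> between them, so it keeps them on opposite sides.\<close>

lemma before_along_trans:
  fixes f s :: "'a \<Rightarrow> nat"
  assumes "chords f s V" "x \<in> V" "y \<in> V" "t \<in> V" "before_along f s z x y" "before_along f s z y t"
  shows "before_along f s z x t"
proof -
  have ne: "x \<noteq> y" "y \<noteq> t" "x \<noteq> t" using assms(5,6) unfolding before_along_def by auto
  have "f x < s x" "f y < s y" "f t < s t"
    "f x \<noteq> f y" "s x \<noteq> s y" "f x \<noteq> s y" "f y \<noteq> s x"
    "f t \<noteq> f y" "s t \<noteq> s y" "f t \<noteq> s y" "f y \<noteq> s t"
    using assms(1-4) ne by (auto simp: chords_def)
  moreover have "crosses f s z x" "crosses f s z y" "crosses f s z t"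
    "\<not> crosses f s x y" "\<not> crosses f s y t"
    "inner f s z x < inner f s z y" "inner f s z y < inner f s z t"
    using assms(5,6) by (auto simp: before_along_def)
  ultimately have "\<not> crosses f s x t"
    unfolding inner_def crosses_def by (simp split: if_splits)
  with assms(5,6) ne show ?thesis unfolding before_along_def by auto
qed

lemma before_along_separates:
  fixes f s :: "'a \<Rightarrow> nat"
  assumes "chords f s V" "x \<in> V" "y \<in> V" "t \<in> V" "before_along f s z x y" "before_along f s z y t"
  shows "separates f s y x t"
proof -
  have ne: "x \<noteq> y" "y \<noteq> t" using assms(5,6) unfolding before_along_def by auto
  have "f x < s x" "f y < s y" "f t < s t"
    "f x \<noteq> f y" "s x \<noteq> s y" "f x \<noteq> s y" "f y \<noteq> s x"
    "f t \<noteq> f y" "s t \<noteq> s y" "f t \<noteq> s y" "f y \<noteq> s t"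
    using assms(1-4) ne by (auto simp: chords_def)
  moreover have "crosses f s z x" "crosses f s z y" "crosses f s z t"
    "\<not> crosses f s x y" "\<not> crosses f s y t"
    "inner f s z x < inner f s z y" "inner f s z y < inner f s z t"
    using assms(5,6) by (auto simp: before_along_def)
  ultimately show ?thesis
    unfolding inner_def crosses_def separates_def by (simp split: if_splits)
qed

text \<open>Either \<open>x\<close> is nested in \<open>y\<close> and \<open>t\<close> is not, or
  \<open>t\<close> is nested in \<open>y\<close> and \<open>x\<close> surrounds or avoids
  both.\<close>

lemma separates_asym:
  fixes f s :: "'a \<Rightarrow> nat"
  assumes "chords f s V" "x \<in> V" "y \<in> V" "t \<in> V" "x \<noteq> y" "y \<noteq> t" "x \<noteq> t"
    and "\<not> crosses f s x y" "\<not> crosses f s y t" "\<not> crosses f s x t"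
    and "separates f s y x t"
  shows "\<not> separates f s x y t"
proof -
  have "f x < s x" "f y < s y" "f t < s t"
    "f x \<noteq> f y" "s x \<noteq> s y" "f x \<noteq> s y" "f y \<noteq> s x"
    "f t \<noteq> f y" "s t \<noteq> s y" "f t \<noteq> s y" "f y \<noteq> s t"
    "f t \<noteq> f x" "s t \<noteq> s x" "f t \<noteq> s x" "f x \<noteq> s t"
    using assms(1-7) by (auto simp: chords_def)
  note ord = this
  have x: "f x < s y \<Longrightarrow> f y < f x \<Longrightarrow> s x < s y" "f x < f y \<Longrightarrow> f y < s x \<Longrightarrow> s y < s x"
    and y: "f t < s y \<Longrightarrow> f y < f t \<Longrightarrow> s t < s y"
    using assms(8,9) ord by (auto simp: crosses_def)
  show ?thesis
  proof (cases "f y < f x \<and> f x < s y")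
    case True
    with x have "s x < s y" by blast
    with True assms(11) ord show ?thesis by (auto simp: separates_def)
  next
    case False
    with assms(11) have t: "f y < f t" "f t < s y" by (auto simp: separates_def)
    with y have "s t < s y" by blast
    show ?thesis
    proof (cases "f x < f y")
      case True
      with x t \<open>s t < s y\<close> ord show ?thesis by (cases "f y < s x") (auto simp: separates_def)
    next
      case False
      then have "s y < f x" using \<open>\<not> (f y < f x \<and> f x < s y)\<close> ord by auto
      with t ord show ?thesis by (auto simp: separates_def)
    qed
  qed
qed

lemma chords_comp:
  assumes "chords f s V" "inj_on g W" "g ` W \<subseteq> V"
  shows "chords (f \<circ> g) (s \<circ> g) W"
  using assms unfolding chords_def inj_on_def comp_def image_subset_iff by metis

definition comparable_along :: "('a \<Rightarrow> 'k::linorder) \<Rightarrow> ('a \<Rightarrow> 'k) \<Rightarrow> 'a \<Rightarrow> 'a \<Rightarrow> 'a \<Rightarrow> bool" where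
  "comparable_along f s z x y \<longleftrightarrow> before_along f s z x y \<or> before_along f s z y x"

text \<open>This makes the order along \<open>z\<close> a transitive orientation of the non-edges
  among the neighbours of \<open>z\<close>.\<close>

lemma comparable_along_iff:
  fixes f s :: "'a \<Rightarrow> nat"
  assumes "chords f s V" and E: "\<And>x y. x \<in> V \<Longrightarrow> y \<in> V \<Longrightarrow> x \<noteq> y \<Longrightarrow> E x y \<longleftrightarrow> crosses f s x y"
    and "z \<in> V" "x \<in> V" "y \<in> V" "z \<noteq> x" "z \<noteq> y" "x \<noteq> y" "E z x" "E z y"
  shows "comparable_along f s z x y \<longleftrightarrow> \<not> E x y"
proof -
  have "crosses f s z x" "crosses f s z y" "crosses f s x y \<longleftrightarrow> E x y" "crosses f s y x \<longleftrightarrow> E x y"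
    using assms E[of z x] E[of z y] E[of x y] by (auto simp: crosses_def)
  then show ?thesis
    using before_along_total[OF assms(1,4,5,8), of z]
    by (auto simp: before_along_def comparable_along_def)
qed

text \<open>All chords cross \<open>0\<close>, so the order along \<open>0\<close> is a transitive orientation of the complement
  of \<open>F\<^sub>0 - 0\<close>. It is forced up to reversal to orient the path \<open>c\<^sub>1, a\<^sub>2, c\<^sub>2\<close> as a directed path,
  although \<open>c\<^sub>1\<close> and \<open>c\<^sub>2\<close> cross.\<close>

lemma F0_not_chords:
  fixes f s :: "nat \<Rightarrow> nat"
  assumes ch: "chords f s F0_V"
    and E: "\<And>x y. x \<in> F0_V \<Longrightarrow> y \<in> F0_V \<Longrightarrow> x \<noteq> y \<Longrightarrow> F0_E x y \<longleftrightarrow> crosses f s x y"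
  shows False
proof -
  let ?T = "before_along f s 0" and ?C = "comparable_along f s 0"
  have trans: "?T x t" if "x \<le> 7" "y \<le> 7" "t \<le> 7" "?T x y" "?T y t" for x y t
    by (rule before_along_trans[OF ch _ _ _ that(4,5)]) (use that(1-3) in \<open>simp_all add: F0_V_def\<close>)
  have C: "?C x y \<longleftrightarrow> \<not> F0_E x y" if "x \<in> {1..7}" "y \<in> {1..7}" "x \<noteq> y" for x y
  proof (rule comparable_along_iff[OF ch E])
    show "F0_E 0 x" "F0_E 0 y" using that by (auto simp: F0_E_def sym_edges_def)
  qed (use that in \<open>auto simp: F0_V_def\<close>)
  have inc: "?C 5 6" "?C 5 7" "?C 6 7" "?C 5 1" "?C 5 4" "?C 6 1" "?C 6 2" "?C 7 2" "?C 7 3"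
    by (simp_all add: C F0_E_def sym_edges_def)
  have "\<not> ?C 1 2" "\<not> ?C 1 7" "\<not> ?C 2 5" "\<not> ?C 3 5" "\<not> ?C 3 6" "\<not> ?C 4 6" "\<not> ?C 4 7"
    by (simp_all add: C F0_E_def sym_edges_def)
  \<comment> \<open>Each instance forbids a directed path with crossing ends. If \<open>5\<close>
    precedes \<open>6\<close>, it precedes \<open>4\<close> and \<open>7\<close>; then
    \<open>3\<close> and \<open>6\<close> precede \<open>7\<close>, and so \<open>2\<close> precedes
    \<open>6\<close> and \<open>6\<close> precedes \<open>1\<close>.\<close>
  then show False
    using inc trans[of 1 6 2] trans[of 1 6 7] trans[of 2 6 5] trans[of 3 7 6] trans[of 5 7 3]
      trans[of 4 5 6] trans[of 7 5 4] trans[of 2 6 1] trans[of 7 6 1] trans[of 5 6 2]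
      trans[of 6 7 3] trans[of 3 7 5] trans[of 6 5 4] trans[of 4 5 7]
    unfolding comparable_along_def by simp blast
qed

text \<open>The order along \<open>c\<^sub>2\<close> forces \<open>b\<^sub>2\<close> to separate \<open>b\<^sub>1\<close> from \<open>a\<^sub>2\<close>, whereas by the symmetry of
  \<open>F\<^sub>1(5)\<close> the order along \<open>c\<^sub>3\<close> forces \<open>b\<^sub>1\<close> to separate \<open>b\<^sub>2\<close> from \<open>a\<^sub>2\<close>.\<close>

lemma F1_5_not_chords:
  fixes f s :: "nat \<Rightarrow> nat"
  assumes ch: "chords f s F1_5_V"
    and E: "\<And>x y. x \<in> F1_5_V \<Longrightarrow> y \<in> F1_5_V \<Longrightarrow> x \<noteq> y \<Longrightarrow> F1_5_E x y \<longleftrightarrow> crosses f s x y"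
  shows False
proof -
  let ?T = "before_along f s" and ?C = "comparable_along f s"
  have between: "?T z b1 b2 \<and> ?T z b2 a2 \<or> ?T z a2 b2 \<and> ?T z b2 b1"
    if V: "{a1, a2, b1, b2, c1, c3, c4} \<subseteq> F1_5_V"
    and inc: "?C z a1 a2" "?C z a1 b1" "?C z a1 b2" "?C z a2 b1" "?C z a2 b2" "?C z b1 b2"
      "?C z a1 c3" "?C z a1 c4" "?C z a2 c1" "?C z a2 c4" "?C z b1 c4" "?C z b2 c1"
    and com: "\<not> ?C z a2 c3" "\<not> ?C z b1 c3" "\<not> ?C z b2 c3" "\<not> ?C z c4 b2" "\<not> ?C z c1 a1"
      "\<not> ?C z c1 b1" "\<not> ?C z c1 c4"
    for z a1 a2 b1 b2 c1 c3 c4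
  proof -
    have trans: "?T z x t"
      if "{x, y, t} \<subseteq> {a1, a2, b1, b2, c1, c3, c4}" "?T z x y" "?T z y t" for x y t
      by (rule before_along_trans[OF ch _ _ _ that(2,3)]) (use that(1) V in auto)
    \<comment> \<open>Up to reversal \<open>a1\<close> precedes \<open>c3\<close>. Crossing ends
      then force \<open>a1\<close> before \<open>a2\<close> and \<open>b2\<close>, \<open>c1\<close>
      before \<open>a2\<close> and \<open>b2\<close>, \<open>b1\<close> before \<open>b2\<close>,
      \<open>c4\<close> before \<open>a2\<close>, and finally \<open>b2\<close> before
      \<open>a2\<close>.\<close>
    show ?thesis
      using inc com trans[of a2 a1 c3] trans[of b1 a1 c3] trans[of b2 a1 c3] trans[of c4 a1 b2]
        trans[of a1 a2 c1] trans[of a1 b2 c1] trans[of c1 b2 b1] trans[of c1 a2 b1]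
        trans[of c4 b1 b2] trans[of c1 a2 c4] trans[of c4 a2 b2]
        trans[of c3 a1 a2] trans[of c3 a1 b1] trans[of c3 a1 b2] trans[of b2 a1 c4]
        trans[of c1 a2 a1] trans[of c1 b2 a1] trans[of b1 b2 c1] trans[of b1 a2 c1]
        trans[of b2 b1 c4] trans[of c4 a2 c1] trans[of b2 a2 c4]
      unfolding comparable_along_def by simp blast
  qed
  note simps = F1_5_V_def F1_5_E_def sym_edges_def
  have C: "?C z x y \<longleftrightarrow> \<not> F1_5_E x y"
    if "F1_5_E z x" "F1_5_E z y" "{x, y, z} \<subseteq> F1_5_V" "x \<noteq> z" "y \<noteq> z" "x \<noteq> y" for x y z
    using comparable_along_iff[OF ch E, of z x y] that by auto
  have 2: "?T 2 8 9 \<and> ?T 2 9 6 \<or> ?T 2 6 9 \<and> ?T 2 9 8"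
    by (rule between[of 5 6 8 9 1 3 4]) (simp_all add: C simps)
  have 3: "?T 3 9 8 \<and> ?T 3 8 6 \<or> ?T 3 6 8 \<and> ?T 3 8 9"
    by (rule between[of 7 6 9 8 4 2 1]) (simp_all add: C simps)
  have V: "6 \<in> F1_5_V" "8 \<in> F1_5_V" "9 \<in> F1_5_V" by (simp_all add: F1_5_V_def)
  have "separates f s 9 8 6"
    using 2 before_along_separates[OF ch, of 8 9 6] before_along_separates[OF ch, of 6 9 8] V
    unfolding separates_def by blast
  moreover have "separates f s 8 9 6"
    using 3 before_along_separates[OF ch, of 9 8 6] before_along_separates[OF ch, of 6 8 9] V
    unfolding separates_def by blast
  moreover have "\<not> crosses f s 8 9" "\<not> crosses f s 9 6" "\<not> crosses f s 8 6"
    using E[of 8 9] E[of 9 6] E[of 8 6] by (simp_all add: simps)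
  ultimately show False
    using separates_asym[OF ch, of 8 9 6] V by simp
qed

section \<open>Excluding 1-uniform and 2-uniform words\<close>

lemma not_two_uniform_if_has_induced:
  assumes "has_induced V E W EW"
    and no: "\<And>f s :: 'b \<Rightarrow> nat. chords f s W \<Longrightarrow>
      (\<And>x y. x \<in> W \<Longrightarrow> y \<in> W \<Longrightarrow> x \<noteq> y \<Longrightarrow> EW x y \<longleftrightarrow> crosses f s x y) \<Longrightarrow> False"
  shows "\<not> (uniform 2 w V \<and> represents w V E)"
proof
  assume "uniform 2 w V \<and> represents w V E"
  then obtain f s :: "'a \<Rightarrow> nat" where fs: "chords f s V"
    "\<And>x y. x \<in> V \<Longrightarrow> y \<in> V \<Longrightarrow> x \<noteq> y \<Longrightarrow> E x y \<longleftrightarrow> crosses f s x y"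
    using chords_of_two_uniform_word by metis
  obtain g where g: "inj_on g W" "g ` W \<subseteq> V" "\<forall>x\<in>W. \<forall>y\<in>W. E (g x) (g y) \<longleftrightarrow> EW x y"
    using assms(1) by (auto simp: has_induced_def)
  show False
  proof (rule no[OF chords_comp[OF fs(1) g(1,2)]])
    fix x y assume xy: "x \<in> W" "y \<in> W" "x \<noteq> y"
    then have "g x \<in> V" "g y \<in> V" "g x \<noteq> g y" using g(1,2) by (auto dest: inj_onD)
    then show "EW x y \<longleftrightarrow> crosses (f \<circ> g) (s \<circ> g) x y"
      using fs(2)[of "g x" "g y"] g(3) xy by (auto simp: crosses_def)
  qed
qed

lemma distinct_if_count_list_le_1: "(\<And>x. count_list w x \<le> 1) \<Longrightarrow> distinct w"
proof (induction w)
  case (Cons y w)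
  have "count_list w x \<le> 1" for x using Cons.prems[of x] by (simp split: if_splits)
  moreover have "y \<notin> set w" using Cons.prems[of y] by (simp add: count_list_0_iff)
  ultimately show ?case using Cons.IH by simp
qed simp

lemma one_uniform_word_represents_complete_graph:
  assumes "uniform 1 w V" "represents w V E" "a \<in> V" "b \<in> V" "a \<noteq> b"
  shows "E a b"
proof -
  have "count_list w x \<le> 1" for x
  proof (cases "x \<in> V")
    case False
    then have "x \<notin> set w" using assms(2) by (auto simp: represents_def)
    then show ?thesis by simp
  qed (use assms(1) in \<open>simp add: uniform_def\<close>)
  then have "distinct w" by (rule distinct_if_count_list_le_1)
  then have "alternate w a b" unfolding alternate_def by (simp add: nth_eq_iff_index_eq)
  then show ?thesis using assms by (auto simp: represents_def)
qed

section \<open>Representations of split comparability graphs\<close>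

text \<open>Ranks start at 1, so that \<open>i x = 0\<close> and \<open>j x = 0\<close> mean that
  \<open>x\<close> has no neighbour in \<open>L\<close> or \<open>R\<close>, respectively.\<close>

locale ranked_split =
  fixes V L R I :: "'a set" and E :: "'a \<Rightarrow> 'a \<Rightarrow> bool" and a b i j :: "'a \<Rightarrow> nat" and p q :: nat
  assumes fin: "finite V" and V: "V = L \<union> R \<union> I"
    and LR: "L \<inter> R = {}" and KI: "(L \<union> R) \<inter> I = {}"
    and sym: "E x y \<Longrightarrow> E y x" and irrefl: "\<not> E x x"
    and clique: "clique E (L \<union> R)" and independent: "independent E I"
    and a: "bij_betw a L {1..p}" and b: "bij_betw b R {1..q}"
    and EL: "l \<in> L \<Longrightarrow> x \<in> I \<Longrightarrow> E x l \<longleftrightarrow> a l \<le> i x"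
    and ER: "r \<in> R \<Longrightarrow> x \<in> I \<Longrightarrow> E x r \<longleftrightarrow> b r \<le> j x"
    and ip: "x \<in> I \<Longrightarrow> i x \<le> p" and jq: "x \<in> I \<Longrightarrow> j x \<le> q"
begin

lemma swap: "ranked_split V R L I E b a j i q p"
proof
  show "V = R \<union> L \<union> I" "R \<inter> L = {}" "(R \<union> L) \<inter> I = {}" "clique E (R \<union> L)"
    using V LR KI clique by (auto simp: Un_commute)
qed (fact fin sym irrefl independent a b EL ER ip jq)+

lemma mem_cases:
  assumes "x \<in> V"
  obtains "x \<in> L" "x \<notin> R" "x \<notin> I" | "x \<notin> L" "x \<in> R" "x \<notin> I" | "x \<notin> L" "x \<notin> R" "x \<in> I"
  using assms V LR KI by blast

lemma aL: "x \<in> L \<Longrightarrow> 1 \<le> a x \<and> a x \<le> p" and bR: "x \<in> R \<Longrightarrow> 1 \<le> b x \<and> b x \<le> q"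
  using a b by (auto simp: bij_betw_def)

lemma a_eq: "x \<in> L \<Longrightarrow> y \<in> L \<Longrightarrow> a x = a y \<longleftrightarrow> x = y"
  and b_eq: "x \<in> R \<Longrightarrow> y \<in> R \<Longrightarrow> b x = b y \<longleftrightarrow> x = y"
  using a b by (auto simp: bij_betw_def dest: inj_onD)

lemma E_eqs:
  "x \<in> L \<Longrightarrow> y \<in> L \<Longrightarrow> E x y \<longleftrightarrow> x \<noteq> y" "x \<in> R \<Longrightarrow> y \<in> R \<Longrightarrow> E x y \<longleftrightarrow> x \<noteq> y"
  "x \<in> L \<Longrightarrow> y \<in> R \<Longrightarrow> E x y" "x \<in> R \<Longrightarrow> y \<in> L \<Longrightarrow> E x y" "x \<in> I \<Longrightarrow> y \<in> I \<Longrightarrow> \<not> E x y"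
  "x \<in> L \<Longrightarrow> y \<in> I \<Longrightarrow> E x y \<longleftrightarrow> a x \<le> i y" "x \<in> R \<Longrightarrow> y \<in> I \<Longrightarrow> E x y \<longleftrightarrow> b x \<le> j y"
proof -
  have comm: "E x y \<longleftrightarrow> E y x" using sym by blast
  have ne: "x \<noteq> y" if "x \<in> L" "y \<in> R" for x y using that LR by blast
  show "x \<in> L \<Longrightarrow> y \<in> L \<Longrightarrow> E x y \<longleftrightarrow> x \<noteq> y" "x \<in> R \<Longrightarrow> y \<in> R \<Longrightarrow> E x y \<longleftrightarrow> x \<noteq> y"
    "x \<in> L \<Longrightarrow> y \<in> R \<Longrightarrow> E x y" "x \<in> R \<Longrightarrow> y \<in> L \<Longrightarrow> E x y" "x \<in> I \<Longrightarrow> y \<in> I \<Longrightarrow> \<not> E x y"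
    using clique independent irrefl ne[of x y] ne[of y x] by (auto simp: clique_def independent_def)
  show "x \<in> L \<Longrightarrow> y \<in> I \<Longrightarrow> E x y \<longleftrightarrow> a x \<le> i y" "x \<in> R \<Longrightarrow> y \<in> I \<Longrightarrow> E x y \<longleftrightarrow> b x \<le> j y"
    using EL ER by (simp_all add: comm)
qed

text \<open>The three keys are linear extensions of the transitive orientation in which a vertex of \<open>I\<close> lies
  above its neighbours in \<open>L\<close> and below those in \<open>R\<close>: it is placed as low as possible in the
  first, as high as possible in the second, and between \<open>L\<close> and \<open>R\<close> in the third, where the
  order of \<open>I\<close> is the reverse of that in the first.\<close>

lemma three_uniform: "\<exists>w. uniform 3 w V \<and> represents w V E"
proof -
  obtain d :: "'a \<Rightarrow> nat" where d: "inj_on d V"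
    using finite_imp_inj_to_nat_seg[OF fin] by blast
  then have d_eq: "d x = d y \<longleftrightarrow> x = y" if "x \<in> I" "y \<in> I" for x y
    using that V by (auto dest: inj_onD)
  \<comment> \<open>\<open>L\<close> takes the even values up to \<open>2 * p\<close>, and
    \<open>R\<close> those from \<open>2 * p + 2\<close> on, by decreasing rank; odd values are left
    for \<open>I\<close>.\<close>
  define K :: "'a \<Rightarrow> int \<times> int \<times> int" where
    "K x = (if x \<in> L then (2 * int (a x), 0, 0) else (2 * int (p + q + 1) - 2 * int (b x), 0, 0))" for x
  define \<kappa> where "\<kappa> x = (if x \<in> I then (2 * int (i x) + 1, int (i x), int (Suc (d x))) else K x)" for x
  define \<mu> where "\<mu> x = (if x \<in> I then (2 * int (p + q + 1) - 2 * int (j x) - 1, 0, int (Suc (d x))) else K x)" for x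
  define \<nu> where "\<nu> x = (if x \<in> I then (2 * int p + 1, - int (i x), - int (Suc (d x))) else K x)" for x
  note defs = \<kappa>_def \<mu>_def \<nu>_def K_def
  have K_eq: "K x = K y \<longleftrightarrow> x = y" if "x \<in> L \<union> R" "y \<in> L \<union> R" for x y
    using that LR aL[of x] aL[of y] bR[of x] bR[of y] a_eq[of x y] b_eq[of x y]
    by (auto simp: K_def)
  have "x = y" if "x \<in> V" "y \<in> V" "\<kappa> x = \<kappa> y \<or> \<mu> x = \<mu> y \<or> \<nu> x = \<nu> y" for x y
  proof (cases "x \<in> I \<or> y \<in> I")
    case True
    then show ?thesis using that(3) d_eq[of x y] by (auto simp: defs split: if_splits)
  next
    case False
    then show ?thesis using that V K_eq[of x y] by (auto simp: \<kappa>_def \<mu>_def \<nu>_def)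
  qed
  then have inj: "inj_on \<kappa> V" "inj_on \<mu> V" "inj_on \<nu> V" by (auto intro!: inj_onI)
  show ?thesis
  proof (rule three_uniform_word_of_keys[OF fin inj])
    show "E x y \<Longrightarrow> E y x" for x y by (rule sym)
  next
    fix x y assume xy: "x \<in> V" "y \<in> V" and lt: "\<kappa> x < \<kappa> y"
    show "E x y \<longleftrightarrow> \<mu> x < \<mu> y \<and> \<nu> x < \<nu> y"
    proof (rule mem_cases[OF xy(1)]; rule mem_cases[OF xy(2)])
    qed (use lt aL[of x] aL[of y] bR[of x] bR[of y] ip[of x] ip[of y] jq[of x] jq[of y]
        in \<open>auto simp: defs less_prod_def E_eqs EL ER\<close>)
  qed
qed

text \<open>The clique is written twice as \<open>L\<close> by decreasing rank followed by \<open>R\<close> by increasing rank. A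
  vertex \<open>x\<close> of \<open>I\<close> is a chord inside the copy given by its colour, around the \<open>i x\<close> last
  letters of \<open>L\<close> and the \<open>j x\<close> first letters of \<open>R\<close>. The third and fourth components
  of the keys nest the chords with a common gap; in the gap between \<open>L\<close> and \<open>R\<close> they put the
  chords that end before those that start, so isolated vertices are moved to the end of the word.\<close>

lemma two_uniform_if_coloured:
  fixes c :: "'a \<Rightarrow> bool"
  assumes c: "\<And>x y. x \<in> I \<Longrightarrow> y \<in> I \<Longrightarrow> c x = c y \<Longrightarrow> i x < i y \<Longrightarrow> j y < j x \<Longrightarrow> i x = 0 \<and> j y = 0"
  shows "\<exists>w. uniform 2 w V \<and> represents w V E"
proof -
  obtain d :: "'a \<Rightarrow> nat" where d: "inj_on d V"
    using finite_imp_inj_to_nat_seg[OF fin] by blast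
  then have d_eq: "d x = d y \<longleftrightarrow> x = y" if "x \<in> I" "y \<in> I" for x y
    using that V by (auto dest: inj_onD)
  \<comment> \<open>\<open>K\<close> is odd, negative on \<open>L\<close> and positive on
    \<open>R\<close>, so the even bounds \<open>- 2 * i x\<close> and \<open>2 * j x\<close> enclose
    exactly the neighbours of \<open>x\<close>.\<close>
  define K :: "'a \<Rightarrow> int" where "K x = (if x \<in> L then 1 - 2 * int (a x) else 2 * int (b x) - 1)" for x
  define copy :: "'a \<Rightarrow> int" where "copy x = (if c x then 0 else 1)" for x
  define f where "f x = (if x \<notin> I then (0, K x, 0, 0)
    else if i x = 0 \<and> j x = 0 then (2, 0, int (d x), 0)
    else (copy x, - 2 * int (i x), int (p + q + 1) - int (j x), int (d x)))" for x
  define s where "s x = (if x \<notin> I then (1, K x, 0, 0)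
    else if i x = 0 \<and> j x = 0 then (2, 0, int (d x), 1)
    else (copy x, 2 * int (j x), int (i x), - int (d x)))" for x
  have K_eq: "K x = K y \<longleftrightarrow> x = y" if "x \<in> L \<union> R" "y \<in> L \<union> R" for x y
    using that LR aL[of x] aL[of y] bR[of x] bR[of y] a_eq[of x y] b_eq[of x y]
    by (auto simp: K_def)
  have "odd (K x)" for x by (simp add: K_def)
  then have par: "K x \<noteq> 2 * n" for x n by (metis dvd_triv_left)
  have fsI: "f x < s x" if "x \<in> I" for x
    using that by (auto simp: f_def s_def)
  have K: "crosses f s x y \<longleftrightarrow> E x y" if "x \<in> L \<union> R" "y \<in> L \<union> R" "x \<noteq> y" for x y
  proof -
    have "E x y" "x \<notin> I" "y \<notin> I" using that clique KI by (auto simp: clique_def)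
    then show ?thesis using K_eq[of x y] that by (auto simp: crosses_def f_def s_def)
  qed
  have KI': "crosses f s x y \<longleftrightarrow> E x y" "crosses f s y x \<longleftrightarrow> E y x" if "x \<in> L \<union> R" "y \<in> I" for x y
  proof -
    have "E x y \<longleftrightarrow> - 2 * int (i y) < K x \<and> K x < 2 * int (j y)"
      using that aL[of x] bR[of x] LR by (auto simp: K_def E_eqs)
    moreover have "x \<notin> I" using that KI by blast
    ultimately show "crosses f s x y \<longleftrightarrow> E x y"
      using that(2) par[of x "- int (i y)"] par[of x "int (j y)"] by (auto simp: crosses_def f_def s_def copy_def)
    then show "crosses f s y x \<longleftrightarrow> E y x" using sym by (auto simp: crosses_def)
  qed
  have ch: "chords f s V"
    unfolding chords_def
  proof (intro conjI ballI impI)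
    fix x assume "x \<in> V"
    then show "f x < s x" using fsI[of x] by (auto simp: f_def s_def)
  next
    fix x y assume xy: "x \<in> V" "y \<in> V" "x \<noteq> y"
    have "(f x \<noteq> f y \<and> s x \<noteq> s y) \<and> f x \<noteq> s y"
    proof (cases "x \<in> I \<or> y \<in> I")
      case True
      then show ?thesis
        using xy(3) d_eq[of x y] par[of x "- int (i y)"] par[of x "int (j y)"] par[of y "- int (i x)"]
          par[of y "int (j x)"] ip[of x] ip[of y] jq[of x] jq[of y]
        by (auto simp: f_def s_def copy_def split: if_splits)
    next
      case False
      then show ?thesis using xy V K_eq[of x y] by (auto simp: f_def s_def)
    qed
    then show "f x \<noteq> f y" "s x \<noteq> s y" "f x \<noteq> s y" by blast+
  qed
  \<comment> \<open>For non-isolated points of equal colour, \<open>f x < f y\<close> gives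
    \<open>i y \<le> i x\<close>, so \<open>y\<close> is nested in \<open>x\<close> unless
    \<open>j x < j y\<close>; then the colouring leaves only chords that are disjoint in the gap
    between \<open>L\<close> and \<open>R\<close>.\<close>
  have "\<not> crosses f s x y" if "x \<in> I" "y \<in> I" "f x < f y" for x y
  proof -
    have "s y < s x \<or> s x < f y"
      using that c[of y x] ip[OF that(1)] ip[OF that(2)] jq[OF that(1)] jq[OF that(2)]
      by (cases "j x < j y"; cases "j x = j y") (auto simp: f_def s_def copy_def split: if_splits)
    then show ?thesis using that(3) by (auto simp: crosses_def)
  qed
  then have I: "\<not> crosses f s x y" if "x \<in> I" "y \<in> I" for x y
    using that by (cases rule: linorder_cases[of "f x" "f y"]) (auto simp: crosses_def)
  show ?thesis
  proof (rule two_uniform_word_of_chords[OF fin ch])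
    fix x y assume "x \<in> V" "y \<in> V" "x \<noteq> y"
    then show "E x y \<longleftrightarrow> crosses f s x y"
      using V K[of x y] KI'[of x y] KI'[of y x] I[of x y] E_eqs(5)[of x y] by blast
  qed
qed
end

section \<open>Coordinates from a transitive orientation\<close>

text \<open>Initial segments of a finite linear order are nested, so sizes decide membership; the
  rank of \<open>x\<close> is the size of its segment, \<open>x\<close> included.\<close>

lemma ranking:
  assumes fin: "finite S"
    and irrefl: "\<And>x. x \<in> S \<Longrightarrow> \<not> R x x"
    and trans: "\<And>x y z. x \<in> S \<Longrightarrow> y \<in> S \<Longrightarrow> z \<in> S \<Longrightarrow> R x y \<Longrightarrow> R y z \<Longrightarrow> R x z"
    and total: "\<And>x y. x \<in> S \<Longrightarrow> y \<in> S \<Longrightarrow> x \<noteq> y \<Longrightarrow> R x y \<or> R y x"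
  obtains a where "bij_betw a S {1..card S}"
    "\<And>D x. D \<subseteq> S \<Longrightarrow> (\<And>y z. z \<in> D \<Longrightarrow> y \<in> S \<Longrightarrow> R y z \<Longrightarrow> y \<in> D) \<Longrightarrow> x \<in> S \<Longrightarrow> x \<in> D \<longleftrightarrow> a x \<le> card D"
proof -
  define below where "below x = {y \<in> S. R y x \<or> y = x}" for x
  define a where "a x = card (below x)" for x
  have fb: "finite (below x)" for x using fin by (simp add: below_def)
  have down: "x \<in> D \<longleftrightarrow> a x \<le> card D"
    if "D \<subseteq> S" "\<And>y z. z \<in> D \<Longrightarrow> y \<in> S \<Longrightarrow> R y z \<Longrightarrow> y \<in> D" "x \<in> S" for D x
  proof
    assume "x \<in> D"
    then have "below x \<subseteq> D" using that by (auto simp: below_def)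
    then show "a x \<le> card D" using that(1) fin by (simp add: a_def card_mono finite_subset)
  next
    assume le: "a x \<le> card D"
    show "x \<in> D"
    proof (rule ccontr)
      assume "x \<notin> D"
      then have "D \<subseteq> below x" using that total by (fastforce simp: below_def)
      moreover have "x \<in> below x" using that by (simp add: below_def)
      ultimately have "D \<subset> below x" using \<open>x \<notin> D\<close> by blast
      then have "card D < a x" using fb by (simp add: a_def psubset_card_mono)
      with le show False by simp
    qed
  qed
  have less: "a x < a y" if "x \<in> S" "y \<in> S" "R x y" for x y
  proof -
    have "below x \<subseteq> below y" using that trans unfolding below_def by blast
    moreover have "y \<in> below y" "y \<notin> below x"
      using that irrefl trans unfolding below_def by blast+
    ultimately have "below x \<subset> below y" by blast
    then show ?thesis using fb by (simp add: a_def psubset_card_mono)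
  qed
  have inj: "inj_on a S"
  proof (rule inj_onI, rule ccontr)
    fix x y assume "x \<in> S" "y \<in> S" "a x = a y" "x \<noteq> y"
    then show False using less[of x y] less[of y x] total[of x y] by auto
  qed
  moreover have "a ` S = {1..card S}"
  proof (rule card_subset_eq)
    have "1 \<le> a x \<and> a x \<le> card S" if "x \<in> S" for x
    proof -
      have "below x \<subseteq> S" "x \<in> below x" using that by (auto simp: below_def)
      then show ?thesis using fb[of x] fin card_mono[of S "below x"]
        by (auto simp: a_def Suc_le_eq card_gt_0_iff)
    qed
    then show "a ` S \<subseteq> {1..card S}" by auto
    show "card (a ` S) = card {1..card S}" using inj by (simp add: card_image)
  qed simp
  ultimately have "bij_betw a S {1..card S}" by (simp add: bij_betw_def)
  then show thesis using that down by blast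
qed

text \<open>A clique vertex between two independent ones would force an edge, so its edges to
  \<open>I\<close> are all outgoing (\<open>L\<close>) or all incoming (\<open>R\<close>). By
  transitivity neighbourhoods are downward closed in \<open>L\<close> and upward closed in
  \<open>R\<close>, so \<open>R\<close> is ranked in reverse.\<close>

lemma ranked_split_exists:
  assumes "graph V E" "split_graph V E" "comparability_graph V E"
  obtains L R I a b i j p q where "ranked_split V L R I E a b i j p q"
proof -
  obtain K I where KI: "K \<union> I = V" "K \<inter> I = {}" "clique E K" "independent E I"
    using assms(2) by (auto simp: split_graph_def)
  obtain P where P: "transitive_orientation V E P"
    using assms(3) by (auto simp: comparability_graph_def)
  have E: "E x y \<longleftrightarrow> P x y \<or> P y x" if "x \<in> V" "y \<in> V" for x y
    using P that unfolding transitive_orientation_def by blast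
  have asym: "\<not> P y x" if "x \<in> V" "y \<in> V" "P x y" for x y
    using P that unfolding transitive_orientation_def by blast
  have trans: "P x z" if "x \<in> V" "y \<in> V" "z \<in> V" "P x y" "P y z" for x y z
    using P that unfolding transitive_orientation_def by blast
  have fin: "finite V" and sym: "\<And>x y. E x y \<Longrightarrow> E y x" and irrefl: "\<And>x. \<not> E x x"
    using assms(1) by (auto simp: graph_def)
  define L where "L = {k \<in> K. \<exists>x\<in>I. P k x}"
  define R where "R = K - L"
  have sub: "L \<subseteq> V" "R \<subseteq> V" "I \<subseteq> V" using KI by (auto simp: L_def R_def)
  have tot: "P x y \<or> P y x" if "x \<in> K" "y \<in> K" "x \<noteq> y" for x y
    using that KI E unfolding clique_def by blast
  have no_path: False if "x \<in> I" "y \<in> I" "k \<in> K" "P x k" "P k y" for x y k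
    using trans[of x k y] E[of x y] that KI by (auto simp: independent_def)
  obtain a where a: "bij_betw a L {1..card L}"
    "\<And>D x. D \<subseteq> L \<Longrightarrow> (\<And>y z. z \<in> D \<Longrightarrow> y \<in> L \<Longrightarrow> P y z \<Longrightarrow> y \<in> D) \<Longrightarrow> x \<in> L \<Longrightarrow> x \<in> D \<longleftrightarrow> a x \<le> card D"
  proof (rule ranking[of L P])
    show "finite L" using sub fin finite_subset by blast
    show "\<not> P x x" if "x \<in> L" for x using asym sub that by blast
    show "P x z" if "x \<in> L" "y \<in> L" "z \<in> L" "P x y" "P y z" for x y z
      using trans sub that by blast
    show "P x y \<or> P y x" if "x \<in> L" "y \<in> L" "x \<noteq> y" for x y
      using tot that by (auto simp: L_def)
  qed blast
  obtain b where b: "bij_betw b R {1..card R}"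
    "\<And>D x. D \<subseteq> R \<Longrightarrow> (\<And>y z. z \<in> D \<Longrightarrow> y \<in> R \<Longrightarrow> P z y \<Longrightarrow> y \<in> D) \<Longrightarrow> x \<in> R \<Longrightarrow> x \<in> D \<longleftrightarrow> b x \<le> card D"
  proof (rule ranking[of R "\<lambda>x y. P y x"])
    show "finite R" using sub fin finite_subset by blast
    show "\<not> P x x" if "x \<in> R" for x using asym sub that by blast
    show "P z x" if "x \<in> R" "y \<in> R" "z \<in> R" "P y x" "P z y" for x y z
      using trans sub that by blast
    show "P y x \<or> P x y" if "x \<in> R" "y \<in> R" "x \<noteq> y" for x y
      using tot that by (auto simp: R_def)
  qed blast
  define i where "i x = card {k \<in> L. P k x}" for x
  define j where "j x = card {k \<in> R. P x k}" for x
  have "ranked_split V L R I E a b i j (card L) (card R)"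
  proof
    show "finite V" by (rule fin)
    show "V = L \<union> R \<union> I" "L \<inter> R = {}" "(L \<union> R) \<inter> I = {}" "clique E (L \<union> R)"
      using KI by (auto simp: L_def R_def clique_def)
    show "independent E I" by (rule KI)
    show "bij_betw a L {1..card L}" "bij_betw b R {1..card R}" by (rule a b)+
    show "E x y \<Longrightarrow> E y x" "\<not> E x x" for x y by (fact sym irrefl)+
    show "i x \<le> card L" "j x \<le> card R" for x
      unfolding i_def j_def using sub fin by (auto intro!: card_mono intro: finite_subset)
    fix x assume x: "x \<in> I"
    show "E x l \<longleftrightarrow> a l \<le> i x" if "l \<in> L" for l
    proof -
      have "E x l \<longleftrightarrow> l \<in> {k \<in> L. P k x}"
        using no_path[OF x, of _ l] E[of x l] x that sub unfolding L_def by blast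
      also have "\<dots> \<longleftrightarrow> a l \<le> card {k \<in> L. P k x}"
        by (rule a(2)) (use that trans sub x in blast)+
      finally show ?thesis by (simp add: i_def)
    qed
    show "E x r \<longleftrightarrow> b r \<le> j x" if "r \<in> R" for r
    proof -
      have "E x r \<longleftrightarrow> r \<in> {k \<in> R. P x k}"
        using E[of x r] x that sub unfolding L_def R_def by blast
      also have "\<dots> \<longleftrightarrow> b r \<le> card {k \<in> R. P x k}"
        by (rule b(2)) (use that trans sub x in blast)+
      finally show ?thesis by (simp add: j_def)
    qed
  qed
  then show thesis by (rule that)
qed

text \<open>\<open>S\<close> and \<open>T\<close> are the points that conflict with the points on the axes \<open>i = 0\<close> and \<open>j = 0\<close>. A pair
  \<open>i x < i y\<close>, \<open>j y < j x\<close> in conflict must be coloured differently; away from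
  the axes there is no antichain of size three, so it suffices to mark the points that are not
  leftmost in such a pair.\<close>

lemma colouring_exists:
  fixes i j :: "'a \<Rightarrow> nat"
  assumes F0: "\<And>x y z. x \<in> I \<Longrightarrow> y \<in> I \<Longrightarrow> z \<in> I \<Longrightarrow> i x < i y \<Longrightarrow> i y < i z \<Longrightarrow> j z < j y \<Longrightarrow> j y < j x
      \<Longrightarrow> i x = 0 \<and> j z = 0"
    and F1: "\<And>a1 a2 a3 b1 b2. {a1, a2, a3, b1, b2} \<subseteq> I \<Longrightarrow> j a1 = 0 \<Longrightarrow> i a3 = 0
      \<Longrightarrow> 0 < i a2 \<Longrightarrow> i a2 < i a1 \<Longrightarrow> 0 < j a2 \<Longrightarrow> j a2 < j a3 \<Longrightarrow> i a1 \<le> i b1 \<Longrightarrow> 0 < j b1 \<Longrightarrow> j b1 < j a3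
      \<Longrightarrow> 0 < i b2 \<Longrightarrow> i b2 < i a1 \<Longrightarrow> j a3 \<le> j b2 \<Longrightarrow> False"
  obtains c :: "'a \<Rightarrow> bool" where
    "\<And>x y. x \<in> I \<Longrightarrow> y \<in> I \<Longrightarrow> c x = c y \<Longrightarrow> i x < i y \<Longrightarrow> j y < j x \<Longrightarrow> i x = 0 \<and> j y = 0"
proof -
  define S where "S x \<longleftrightarrow> 0 < i x \<and> 0 < j x \<and> (\<exists>y\<in>I. i y = 0 \<and> j x < j y)" for x
  define T where "T x \<longleftrightarrow> 0 < i x \<and> 0 < j x \<and> (\<exists>y\<in>I. j y = 0 \<and> i x < i y)" for x
  define W where "W x \<longleftrightarrow> (\<exists>z\<in>I. 0 < j z \<and> i z < i x \<and> j x < j z)" for x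
  define W' where "W' x \<longleftrightarrow> (\<exists>z\<in>I. 0 < i z \<and> j z < j x \<and> i x < i z)" for x
  \<comment> \<open>The point \<open>z\<close> from \<open>W x\<close> completes an antichain of
    size three, so \<open>z\<close> and \<open>y\<close> lie on the axes and witness
    \<open>S x\<close> and \<open>T x\<close>.\<close>
  have W: "j y = 0 \<and> S x \<and> T x" if "x \<in> I" "y \<in> I" "i x < i y" "j y < j x" "W x" for x y
  proof -
    obtain z where "z \<in> I" "i z < i x" "j x < j z" using \<open>W x\<close> by (auto simp: W_def)
    moreover from this have "i z = 0 \<and> j y = 0" using F0[of z x y] that by blast
    ultimately show ?thesis using that by (auto simp: S_def T_def)
  qed
  have W': "i x = 0 \<and> S y \<and> T y" if "x \<in> I" "y \<in> I" "i x < i y" "j y < j x" "W' y" for x y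
  proof -
    obtain z where "z \<in> I" "j z < j y" "i y < i z" using \<open>W' y\<close> by (auto simp: W'_def)
    moreover from this have "i x = 0 \<and> j z = 0" using F0[of x y z] that by blast
    ultimately show ?thesis using that by (auto simp: S_def T_def)
  qed
  \<comment> \<open>A colouring exists unless \<open>S\<close> and \<open>T\<close> overlap with
    neither containing the other; that last case yields F_1(5).\<close>
  consider (disj) "\<forall>x\<in>I. \<not> (S x \<and> T x)" | (TS) "\<forall>x\<in>I. T x \<longrightarrow> S x" | (ST) "\<forall>x\<in>I. S x \<longrightarrow> T x"
    | (bad) a2 b1 b2 where "a2 \<in> I" "b1 \<in> I" "b2 \<in> I" "S a2" "T a2" "S b1" "\<not> T b1" "T b2" "\<not> S b2"
    by blast
  then show thesis
  proof cases
    case disj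
    show thesis
    \<comment> \<open>The axis \<open>j = 0\<close> joins the right-hand points; a conflicting pair
      of equal colour would put its left point in \<open>S\<close> and \<open>T\<close>.\<close>
    proof (rule that[of "\<lambda>x. j x = 0 \<or> W x"])
      fix x y assume xy: "x \<in> I" "y \<in> I" "i x < i y" "j y < j x" and c: "(j x = 0 \<or> W x) = (j y = 0 \<or> W y)"
      then have "W y" if "0 < j y"
        unfolding W_def using that xy by (intro bexI[of _ x]) auto
      with c xy(4) have "W x" by auto
      with W[OF xy] disj xy(1) show "i x = 0 \<and> j y = 0" by blast
    qed
  next
    case TS
    show thesis
    \<comment> \<open>The axis \<open>j = 0\<close> now takes the other colour; a point in
      \<open>T\<close> lies in \<open>S\<close> and hence satisfies \<open>W\<close>.\<close>
    proof (rule that[of "\<lambda>x. 0 < j x \<and> W x"])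
      fix x y assume xy: "x \<in> I" "y \<in> I" "i x < i y" "j y < j x" and c: "(0 < j x \<and> W x) = (0 < j y \<and> W y)"
      have "j y = 0"
      proof (rule ccontr)
        assume "j y \<noteq> 0"
        then have "W y" unfolding W_def using xy by (intro bexI[of _ x]) auto
        then have "W x" using c \<open>j y \<noteq> 0\<close> by simp
        with W[OF xy] \<open>j y \<noteq> 0\<close> show False by blast
      qed
      moreover have "i x = 0"
      proof (rule ccontr)
        assume "i x \<noteq> 0"
        then have "T x" using \<open>j y = 0\<close> xy by (auto simp: T_def)
        then have "S x" using TS xy(1) by blast
        then obtain z where "z \<in> I" "i z = 0" "j x < j z" by (auto simp: S_def)
        then have "W x" unfolding W_def using \<open>i x \<noteq> 0\<close> by (intro bexI[of _ z]) auto
        then show False using c xy \<open>j y = 0\<close> by simp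
      qed
      ultimately show "i x = 0 \<and> j y = 0" by simp
    qed
  next
    case ST
    show thesis
    proof (rule that[of "\<lambda>x. 0 < i x \<and> W' x"])
      fix x y assume xy: "x \<in> I" "y \<in> I" "i x < i y" "j y < j x" and c: "(0 < i x \<and> W' x) = (0 < i y \<and> W' y)"
      have "i x = 0"
      proof (rule ccontr)
        assume "i x \<noteq> 0"
        have "W' x" unfolding W'_def using xy by (intro bexI[of _ y]) auto
        then have "W' y" using c \<open>i x \<noteq> 0\<close> by simp
        with W'[OF xy] \<open>i x \<noteq> 0\<close> show False by blast
      qed
      moreover have "j y = 0"
      proof (rule ccontr)
        assume "j y \<noteq> 0"
        then have "S y" using \<open>i x = 0\<close> xy by (auto simp: S_def)
        then have "T y" using ST xy(2) by blast
        then obtain z where "z \<in> I" "j z = 0" "i y < i z" by (auto simp: T_def)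
        then have "W' y" unfolding W'_def using \<open>j y \<noteq> 0\<close> by (intro bexI[of _ z]) auto
        then show False using c xy \<open>i x = 0\<close> by simp
      qed
      ultimately show "i x = 0 \<and> j y = 0" by simp
    qed
  next
    case bad
    \<comment> \<open>Of the witnesses for \<open>a2\<close> and \<open>b1\<close>, the one with
      larger \<open>j\<close> serves both; \<open>a1\<close> is chosen likewise by larger
      \<open>i\<close>.\<close>
    obtain a3 where a3: "a3 \<in> I" "i a3 = 0" "j a2 < j a3" "j b1 < j a3"
      using bad(4,6) unfolding S_def by (metis less_trans linorder_less_linear)
    obtain a1 where a1: "a1 \<in> I" "j a1 = 0" "i a2 < i a1" "i b2 < i a1"
      using bad(5,8) unfolding T_def by (metis less_trans linorder_less_linear)
    have "i a1 \<le> i b1" "j a3 \<le> j b2"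
      using bad a1 a3 unfolding S_def T_def by (metis not_less)+
    then show thesis
      using F1[of a1 a2 a3 b1 b2] bad a1 a3 by (auto simp: S_def T_def)
  qed
qed

section \<open>Induced copies of F_0 and F_1(5)\<close>

lemma has_induced_F0I:
  assumes "{c0, c1, c2, c3, c4, a1, a2, a3} \<subseteq> V" "distinct [c0, c1, c2, c3, c4, a1, a2, a3]"
    and sym: "\<And>x y. E x y \<Longrightarrow> E y x" and irrefl: "\<And>x. \<not> E x x"
    and "clique E {c0, c1, c2, c3, c4}" "independent E {a1, a2, a3}"
    and "E a1 c0" "\<not> E a1 c1" "E a1 c2" "E a1 c3" "\<not> E a1 c4"
    and "E a2 c0" "\<not> E a2 c1" "\<not> E a2 c2" "E a2 c3" "E a2 c4"
    and "E a3 c0" "E a3 c1" "\<not> E a3 c2" "\<not> E a3 c3" "E a3 c4"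
  shows "has_induced V E F0_V F0_E"
proof -
  let ?vs = "[c0, c1, c2, c3, c4, a1, a2, a3]"
  have V: "F0_V = {..<length ?vs}" by (auto simp: F0_V_def)
  have comm: "E x y \<longleftrightarrow> E y x" for x y using sym by blast
  have "\<forall>x\<in>{0,1,2,3,4,5,6,7}. \<forall>y\<in>{0,1,2,3,4,5,6,7}. E (?vs ! x) (?vs ! y) \<longleftrightarrow> F0_E x y"
    using assms(2,5-) by (simp add: F0_E_def sym_edges_def clique_def independent_def comm irrefl)
  moreover have "F0_V = {0,1,2,3,4,5,6,7}" by (auto simp: F0_V_def)
  ultimately have "\<forall>x\<in>F0_V. \<forall>y\<in>F0_V. E (?vs ! x) (?vs ! y) \<longleftrightarrow> F0_E x y"
    by (simp only:)
  moreover have "inj_on ((!) ?vs) F0_V" unfolding V using assms(2) by (intro inj_on_nth) auto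
  moreover have "(!) ?vs ` F0_V \<subseteq> V" using assms(1) unfolding V by (force simp: less_Suc_eq)
  ultimately show ?thesis unfolding has_induced_def by blast
qed

lemma has_induced_F1_5I:
  assumes "{c1, c2, c3, c4, a1, a2, a3, b1, b2} \<subseteq> V" "distinct [c1, c2, c3, c4, a1, a2, a3, b1, b2]"
    and sym: "\<And>x y. E x y \<Longrightarrow> E y x" and irrefl: "\<And>x. \<not> E x x"
    and "clique E {c1, c2, c3, c4}" "independent E {a1, a2, a3, b1, b2}"
    and "E a1 c1" "E a1 c2" "\<not> E a1 c3" "\<not> E a1 c4"
    and "\<not> E a2 c1" "E a2 c2" "E a2 c3" "\<not> E a2 c4"
    and "\<not> E a3 c1" "\<not> E a3 c2" "E a3 c3" "E a3 c4"
    and "E b1 c1" "E b1 c2" "E b1 c3" "\<not> E b1 c4"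
    and "\<not> E b2 c1" "E b2 c2" "E b2 c3" "E b2 c4"
  shows "has_induced V E F1_5_V F1_5_E"
proof -
  let ?vs = "[c1, c2, c3, c4, a1, a2, a3, b1, b2]"
  let ?g = "\<lambda>n. ?vs ! (n - 1)"
  have comm: "E x y \<longleftrightarrow> E y x" for x y using sym by blast
  have "\<forall>x\<in>{1,2,3,4,5,6,7,8,9}. \<forall>y\<in>{1,2,3,4,5,6,7,8,9}. E (?g x) (?g y) \<longleftrightarrow> F1_5_E x y"
    using assms(2,5-) by (simp add: F1_5_E_def sym_edges_def clique_def independent_def comm irrefl)
  moreover have V: "F1_5_V = {1,2,3,4,5,6,7,8,9}" by (auto simp: F1_5_V_def)
  ultimately have "\<forall>x\<in>F1_5_V. \<forall>y\<in>F1_5_V. E (?g x) (?g y) \<longleftrightarrow> F1_5_E x y"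
    by (simp only:)
  moreover have "inj_on ?g F1_5_V"
    by (intro inj_onI) (use assms(2) in \<open>auto simp: F1_5_V_def nth_eq_iff_index_eq\<close>)
  moreover have "?g ` F1_5_V \<subseteq> V" using assms(1) unfolding V by simp
  ultimately show ?thesis unfolding has_induced_def by blast
qed

context ranked_split
begin

lemma rank_L_exists: "1 \<le> n \<Longrightarrow> n \<le> p \<Longrightarrow> \<exists>l\<in>L. a l = n"
  and rank_R_exists: "1 \<le> n \<Longrightarrow> n \<le> q \<Longrightarrow> \<exists>r\<in>R. b r = n"
  using a b by (metis atLeastAtMost_iff bij_betw_def imageE)+

text \<open>The vertex of rank 1 in \<open>R\<close> is adjacent to all three points; the ranks
  \<open>i y\<close>, \<open>i z\<close>, \<open>j y\<close> and \<open>j x\<close> are thresholds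
  that tell them apart.\<close>

lemma has_induced_F0_of_antichain:
  assumes "x \<in> I" "y \<in> I" "z \<in> I" and "i x < i y" "i y < i z" "j z < j y" "j y < j x" "0 < j z"
  shows "has_induced V E F0_V F0_E"
proof -
  obtain l2 l3 where l: "l2 \<in> L" "a l2 = i y" "l3 \<in> L" "a l3 = i z"
    using assms ip[of y] ip[of z] rank_L_exists[of "i y"] rank_L_exists[of "i z"] by auto
  obtain r1 r2 r3 where r: "r1 \<in> R" "b r1 = 1" "r2 \<in> R" "b r2 = j y" "r3 \<in> R" "b r3 = j x"
    using assms jq[of y] jq[of x] rank_R_exists[of 1] rank_R_exists[of "j y"] rank_R_exists[of "j x"] by auto
  show ?thesis
  proof (rule has_induced_F0I[of r1 l3 r3 r2 l2 x y z])
    show "distinct [r1, l3, r3, r2, l2, x, y, z]"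
      using l r assms LR KI a_eq[of l2 l3] b_eq[of r1 r2] b_eq[of r1 r3] b_eq[of r2 r3] by auto
    show "clique E {r1, l3, r3, r2, l2}" "independent E {x, y, z}"
      using clique independent l r assms unfolding clique_def independent_def by blast+
    show "{r1, l3, r3, r2, l2, x, y, z} \<subseteq> V" using l r assms V by blast
  qed (use l r assms in \<open>auto simp: EL ER irrefl intro: sym\<close>)
qed

text \<open>The clique consists of rank 1 in each half together with the thresholds of the axis
  points, \<open>i a1\<close> in \<open>L\<close> and \<open>j a3\<close> in
  \<open>R\<close>.\<close>

lemma has_induced_F1_5_of_points:
  assumes "{a1, a2, a3, b1, b2} \<subseteq> I" "j a1 = 0" "i a3 = 0"
    and "0 < i a2" "i a2 < i a1" "0 < j a2" "j a2 < j a3" "i a1 \<le> i b1" "0 < j b1" "j b1 < j a3"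
    and "0 < i b2" "i b2 < i a1" "j a3 \<le> j b2"
  shows "has_induced V E F1_5_V F1_5_E"
proof -
  obtain l1 l2 where l: "l1 \<in> L" "a l1 = 1" "l2 \<in> L" "a l2 = i a1"
    using assms ip[of a1] rank_L_exists[of 1] rank_L_exists[of "i a1"] by auto
  obtain r1 r2 where r: "r1 \<in> R" "b r1 = 1" "r2 \<in> R" "b r2 = j a3"
    using assms jq[of a3] rank_R_exists[of 1] rank_R_exists[of "j a3"] by auto
  show ?thesis
  proof (rule has_induced_F1_5I[of l2 l1 r1 r2 a1 a2 a3 b1 b2])
    show "distinct [l2, l1, r1, r2, a1, a2, a3, b1, b2]"
      using l r assms LR KI by auto
    show "clique E {l2, l1, r1, r2}" "independent E {a1, a2, a3, b1, b2}"
      using clique independent l r assms(1) unfolding clique_def independent_def by blast+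
    show "{l2, l1, r1, r2, a1, a2, a3, b1, b2} \<subseteq> V" using l r assms(1) V by blast
  qed (use l r assms in \<open>auto simp: EL ER irrefl intro: sym\<close>)
qed

lemma two_uniform_if_no_induced:
  assumes "\<not> has_induced V E F0_V F0_E" "\<not> has_induced V E F1_5_V F1_5_E"
  shows "\<exists>w. uniform 2 w V \<and> represents w V E"
proof -
  interpret swapped: ranked_split V R L I E b a j i q p by (rule swap)
  obtain c :: "'a \<Rightarrow> bool" where
    "\<And>x y. x \<in> I \<Longrightarrow> y \<in> I \<Longrightarrow> c x = c y \<Longrightarrow> i x < i y \<Longrightarrow> j y < j x \<Longrightarrow> i x = 0 \<and> j y = 0"
  proof (rule colouring_exists[of I i j])
    \<comment> \<open>A positive \<open>j z\<close> yields F_0 directly, a positive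
      \<open>i x\<close> in the mirror image with the points reversed.\<close>
    show "i x = 0 \<and> j z = 0" if "x \<in> I" "y \<in> I" "z \<in> I" "i x < i y" "i y < i z" "j z < j y" "j y < j x" for x y z
      using has_induced_F0_of_antichain[of x y z] swapped.has_induced_F0_of_antichain[of z y x] assms(1) that
      by auto
  next
    fix a1 a2 a3 b1 b2
    assume "{a1, a2, a3, b1, b2} \<subseteq> I" "j a1 = 0" "i a3 = 0"
      "0 < i a2" "i a2 < i a1" "0 < j a2" "j a2 < j a3" "i a1 \<le> i b1" "0 < j b1" "j b1 < j a3"
      "0 < i b2" "i b2 < i a1" "j a3 \<le> j b2"
    then show False using has_induced_F1_5_of_points assms(2) by blast
  qed blast
  then show ?thesis by (rule two_uniform_if_coloured)
qed

end

section \<open>The representation number\<close>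

lemma not_one_uniform_if_has_induced:
  assumes "has_induced V E W EW" "x \<in> W" "y \<in> W" "x \<noteq> y" "\<not> EW x y"
  shows "\<not> (uniform 1 w V \<and> represents w V E)"
proof
  assume w: "uniform 1 w V \<and> represents w V E"
  obtain g where g: "inj_on g W" "g ` W \<subseteq> V" "\<forall>x\<in>W. \<forall>y\<in>W. E (g x) (g y) \<longleftrightarrow> EW x y"
    using assms(1) by (auto simp: has_induced_def)
  then have "g x \<in> V" "g y \<in> V" "g x \<noteq> g y" using assms(2-4) by (auto dest: inj_onD)
  then have "E (g x) (g y)" using one_uniform_word_represents_complete_graph w by metis
  then show False using g(3) assms(2,3,5) by blast
qed

theorem theorem8:
  fixes V :: "'a set" and E :: "'a \<Rightarrow> 'a \<Rightarrow> bool"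
  assumes "graph V E" and "split_graph V E" and "comparability_graph V E"
  shows "rep_number V E = 3 \<longleftrightarrow>
           (has_induced V E F0_V F0_E \<or> has_induced V E F1_5_V F1_5_E)"
proof -
  obtain L R I a b i j p q where "ranked_split V L R I E a b i j p q"
    using ranked_split_exists[OF assms] .
  then interpret ranked_split V L R I E a b i j p q .
  define P where "P k \<longleftrightarrow> 1 \<le> k \<and> (\<exists>w. uniform k w V \<and> represents w V E)" for k
  have rep: "rep_number V E = (LEAST k. P k)" by (simp add: rep_number_def P_def)
  have "P 3" using three_uniform by (simp add: P_def)
  show ?thesis
  proof
    assume "rep_number V E = 3"
    then have "\<not> P 2" using not_less_Least[of 2 P] rep by simp
    then show "has_induced V E F0_V F0_E \<or> has_induced V E F1_5_V F1_5_E"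
      using two_uniform_if_no_induced by (auto simp: P_def)
  next
    assume H: "has_induced V E F0_V F0_E \<or> has_induced V E F1_5_V F1_5_E"
    \<comment> \<open>The vertices \<open>5\<close> and \<open>6\<close> are a_1 and a_2,
      nonadjacent in both graphs.\<close>
    have "\<not> P 1"
      using H not_one_uniform_if_has_induced[of V E F0_V F0_E 5 6]
        not_one_uniform_if_has_induced[of V E F1_5_V F1_5_E 5 6]
      by (auto simp: P_def F0_V_def F0_E_def F1_5_V_def F1_5_E_def sym_edges_def)
    have "\<not> (uniform 2 w V \<and> represents w V E)" for w
      using H
    proof
      assume "has_induced V E F0_V F0_E"
      then show ?thesis by (rule not_two_uniform_if_has_induced) (fact F0_not_chords)
    next
      assume "has_induced V E F1_5_V F1_5_E"
      then show ?thesis by (rule not_two_uniform_if_has_induced) (fact F1_5_not_chords)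
    qed
    then have "\<not> P 2" by (simp add: P_def)
    have "\<not> P 0" by (simp add: P_def)
    have "3 \<le> k" if "P k" for k
    proof -
      have "k \<noteq> 0" "k \<noteq> 1" "k \<noteq> 2" using \<open>P k\<close> \<open>\<not> P 0\<close> \<open>\<not> P 1\<close> \<open>\<not> P 2\<close> by metis+
      then show ?thesis by simp
    qed
    then show "rep_number V E = 3" unfolding rep using Least_equality[of P 3] \<open>P 3\<close> by blast
  qed
qed

end
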